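(* Let $n\ge 2$ and let $\mathcal{F}=[1,2,\ldots,n]$ be the $n\times n$-Ferrers diagram of upper triangular shape, so that $\mathbb{F}_q[\mathcal{F}]$ is the space of upper triangular $n\times n$-matrices over $\mathbb{F}_q$. Let $\delta=n-1$; then $\nu_{\min}(\mathcal{F};n-1)=3$. For every prime power $q$ there exists a maximal $[\mathcal{F};n-1]_q$-code, i.e. a $3$-dimensional $\mathbb{F}_q$-subspace of $\mathbb{F}_q[\mathcal{F}]$ with rank distance $n-1$.
   Context: The tuple $[c_1,\ldots,c_n]$ denotes the Ferrers diagram $\mathcal{F}=\{(i,j): 1\le i\le c_j\}$, and $\mathbb{F}_q[\mathcal{F}]$ is the space of all matrices over $\mathbb{F}_q$ whose nonzero entries occur only at positions in $\mathcal{F}$. The rank distance of a subspace of matrices is the minimum rank of its nonzero elements. For $j=0,\ldots,\delta-1$ put $\nu_j(\mathcal{F};\delta)=\sum_{t=1}^{n-\delta+1+j}\max\{c_t-j,0\}$ and $\nu_{\min}(\mathcal{F};\delta)=\min\{\nu_0,\ldots,\nu_{\delta-1}\}$. A maximal $[\mathcal{F};\delta]_q$-code is a subspace of $\mathbb{F}_q[\mathcal{F}]$ with rank distance $\delta$ and dimension $\nu_{\min}(\mathcal{F};\delta)$. *)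

theory Defs
  imports "Jordan_Normal_Form.DL_Rank"
begin

text \<open>A Ferrers diagram is given by its list of column lengths \<open>cs = [c\<^sub>1, \<dots>, c\<^sub>n]\<close>; the dots carry
  1-based indices, so that \<open>c\<^sub>j\<close> is \<open>cs ! (j - 1)\<close>.\<close>

definition ferrers :: "nat list \<Rightarrow> (nat \<times> nat) set" where
  "ferrers cs = {(i, j). 1 \<le> j \<and> j \<le> length cs \<and> 1 \<le> i \<and> i \<le> cs ! (j - 1)}"

text \<open>The space \<open>\<bbbF>[\<F>]\<close> of \<open>m \<times> n\<close>-matrices supported on the diagram, where \<open>n = length cs\<close>.
  Matrix entries of the library are indexed from 0, hence the shift. The ground field is the
  type \<open>'a\<close>.\<close>

definition ferrers_space :: "nat \<Rightarrow> nat list \<Rightarrow> 'a::field mat set" where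
  "ferrers_space m cs = {A \<in> carrier_mat m (length cs).
     \<forall>i < m. \<forall>j < length cs. A $$ (i, j) \<noteq> 0 \<longrightarrow> (i + 1, j + 1) \<in> ferrers cs}"

text \<open>For \<open>\<delta> \<le> n\<close> the upper summation bound is \<open>n - \<delta> + 1 + j\<close>; the truncated subtraction
  \<open>c\<^sub>t - j\<close> on natural numbers is \<open>max {c\<^sub>t - j, 0}\<close>.\<close>

definition nu :: "nat list \<Rightarrow> nat \<Rightarrow> nat \<Rightarrow> nat" where
  "nu cs \<delta> j = (\<Sum>t = 1..length cs + 1 + j - \<delta>. cs ! (t - 1) - j)"

definition nu_min :: "nat list \<Rightarrow> nat \<Rightarrow> nat" where
  "nu_min cs \<delta> = Min (nu cs \<delta> ` {0..<\<delta>})"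

text \<open>The infimum is a minimum as soon as \<open>C\<close> contains a nonzero matrix. The index \<open>m\<close> of
  \<open>vec_space.rank\<close> is the number of rows (the length of the column vectors).\<close>

definition rank_distance :: "nat \<Rightarrow> nat \<Rightarrow> 'a::field mat set \<Rightarrow> nat" where
  "rank_distance m n C = Inf (vec_space.rank m ` (C - {0\<^sub>m m n}))"

definition mat_dim :: "nat \<Rightarrow> nat \<Rightarrow> 'a::field mat set \<Rightarrow> nat" where
  "mat_dim m n C = vectorspace.dim class_ring ((module_mat TYPE('a) m n)\<lparr>carrier := C\<rparr>)"

definition maximal_ferrers_code :: "nat \<Rightarrow> nat list \<Rightarrow> nat \<Rightarrow> 'a::{field,finite} mat set \<Rightarrow> bool" where
  "maximal_ferrers_code m cs \<delta> C \<longleftrightarrow>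
     subspace class_ring C (module_mat TYPE('a) m (length cs)) \<and>
     C \<subseteq> ferrers_space m cs \<and>
     rank_distance m (length cs) C = \<delta> \<and>
     mat_dim m (length cs) C = nu_min cs \<delta>"

end

theory Submission
  imports Defs
begin

text \<open>The code consists of the banded matrices with diagonal \<open>x, y, x, y, \<dots>\<close>, superdiagonal \<open>z\<close>
  and second superdiagonal \<open>f = a (x + y) + z\<close>. If \<open>x y \<noteq> 0\<close> such a matrix is invertible. If
  \<open>x = y = 0\<close> it is strictly upper triangular with superdiagonal \<open>z \<noteq> 0\<close>. If, say, only \<open>x = 0\<close>,
  eliminating the rows with diagonal entry \<open>y\<close> leaves, up to the factor \<open>y\<close>, a strictly upper
  triangular matrix with superdiagonal entries \<open>y f - z\<^sup>2 = a y\<^sup>2 + y z - z\<^sup>2\<close>. Choosing \<open>a\<close>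
  outside the range of \<open>t \<mapsto> t\<^sup>2 - t\<close>, which is not injective and hence not surjective on a finite
  field, makes this form anisotropic, so that the rank drops by at most one.\<close>

section \<open>Rank at least n - 1 from a kernel condition\<close>

lemma rank_Suc_ge:
  fixes A :: "'a::field mat"
  assumes A: "A \<in> carrier_mat n n" and k: "k < n"
    and inj: "\<And>v. v \<in> carrier_vec n \<Longrightarrow> A *\<^sub>v v = 0\<^sub>v n \<Longrightarrow> v $ k = 0 \<Longrightarrow> v = 0\<^sub>v n"
  shows "n \<le> Suc (vec_space.rank n A)"
  \<comment> \<open>A left kernel vector \<open>w\<close> with \<open>w $ r \<noteq> 0\<close> shows that adding 1 at position \<open>(r, k)\<close> makes \<open>A\<close>
    invertible.\<close>
proof (cases "det A = 0")
  case False
  then show ?thesis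
    using vec_space.det_rank_iff[OF A] by simp
next
  case True
  then have "det (transpose_mat A) = 0"
    using det_transpose[OF A] by simp
  then obtain w where w: "w \<in> carrier_vec n" "w \<noteq> 0\<^sub>v n" "transpose_mat A *\<^sub>v w = 0\<^sub>v n"
    using det_0_iff_vec_prod_zero_field[of "transpose_mat A" n] A by auto
  then obtain r where r: "r < n" "w $ r \<noteq> 0"
    by (metis carrier_vecD eq_vecI index_zero_vec(1) index_zero_vec(2))
  \<comment> \<open>The entries are written as a product of a row factor and a column factor, the
    shape in which the rank of \<open>E\<close> is seen to be at most 1.\<close>
  define E :: "'a mat" where
    "E = mat n n (\<lambda>(i, j). (if i = r then 1 else 0) * (if j = k then 1 else 0))"
  have E: "E \<in> carrier_mat n n"
    by (simp add: E_def)
  have Ev: "E *\<^sub>v v = v $ k \<cdot>\<^sub>v unit_vec n r" if "v \<in> carrier_vec n" for v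
  proof (rule eq_vecI)
    fix i assume "i < dim_vec (v $ k \<cdot>\<^sub>v unit_vec n r)"
    then show "(E *\<^sub>v v) $ i = (v $ k \<cdot>\<^sub>v unit_vec n r) $ i"
      using that k by (cases "i = r")
        (simp_all add: E_def scalar_prod_def unit_vec_def if_distrib[of "\<lambda>x. x * _"] cong: if_cong)
  qed (simp add: E_def)
  have "det (A + E) \<noteq> 0"
  proof
    assume "det (A + E) = 0"
    then obtain v where v: "v \<in> carrier_vec n" "v \<noteq> 0\<^sub>v n" "(A + E) *\<^sub>v v = 0\<^sub>v n"
      using det_0_iff_vec_prod_zero_field[of "A + E" n] A E by auto
    have sum0: "A *\<^sub>v v + E *\<^sub>v v = 0\<^sub>v n"
      using v add_mult_distrib_mat_vec[OF A E v(1)] by simp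
    \<comment> \<open>Since \<open>w\<close> is orthogonal to the range of \<open>A\<close>, pairing
      \<open>sum0\<close> with \<open>w\<close> leaves only \<open>v $ k * w $ r\<close>.\<close>
    have "w \<bullet> (A *\<^sub>v v) = (transpose_mat A *\<^sub>v w) \<bullet> v"
      using transpose_vec_mult_scalar[OF A v(1) w(1)] by simp
    then have "w \<bullet> (A *\<^sub>v v) = 0"
      using v w by simp
    moreover have "w \<bullet> (A *\<^sub>v v) + w \<bullet> (E *\<^sub>v v) = 0"
      using sum0 scalar_prod_add_distrib[OF w(1), of "A *\<^sub>v v" "E *\<^sub>v v"] A E v w by simp
    ultimately have "v $ k * w $ r = 0"
      using Ev[OF v(1)] w r by simp
    then have vk: "v $ k = 0"
      using r by simp
    then have "E *\<^sub>v v = 0\<^sub>v n"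
      using Ev[OF v(1)] by (auto intro!: eq_vecI)
    then have "A *\<^sub>v v = 0\<^sub>v n"
      using sum0 A v by (metis mult_mat_vec_carrier right_zero_vec)
    then show False
      using inj v vk by blast
  qed
  then have "n = vec_space.rank n (A + E)"
    using vec_space.det_rank_iff[of "A + E" n] A E by simp
  also have "\<dots> \<le> vec_space.rank n A + vec_space.rank n E"
    by (rule vec_space.rank_subadditive[OF A E])
  also have "vec_space.rank n E \<le> 1"
    by (rule vec_space.rank_le_1_product_entries[OF E]) (simp add: E_def)
  finally show ?thesis by simp
qed

section \<open>An anisotropic binary quadratic form\<close>

lemma exists_square_minus_self_avoids:
  "\<exists>a::'a::{field,finite}. \<forall>t. t * t - t \<noteq> a"
proof (rule ccontr)
  assume "\<nexists>a::'a. \<forall>t. t * t - t \<noteq> a"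
  then have "surj (\<lambda>t::'a. t * t - t)"
    by (metis surjI surj_def)
  then have "inj (\<lambda>t::'a. t * t - t)"
    by (simp add: finite_UNIV_surj_inj)
  \<comment> \<open>Both 0 and 1 are sent to 0.\<close>
  then have "(0::'a) = 1"
    by (rule injD) simp
  then show False by simp
qed

text \<open>If \<open>s\<close> were nonzero, dividing the form by the square of \<open>s\<close>
  would exhibit \<open>a\<close> as the value of \<open>t * t - t\<close> at
  \<open>t = z / s\<close>.\<close>

lemma binary_form_anisotropic:
  fixes a s z :: "'a::field"
  assumes a: "\<And>t. t * t - t \<noteq> a" and 0: "s * (a * s + z) - z * z = 0"
  shows "s = 0 \<and> z = 0"
proof (cases "s = 0")
  case True
  then show ?thesis using 0 by simp
next
  case False
  have "(z / s) * (z / s) - z / s = a"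
    using 0 False by (simp add: field_simps)
  then show ?thesis using a by blast
qed

section \<open>The banded matrices and their rank\<close>

text \<open>When one of \<open>x\<close>, \<open>y\<close> vanishes, \<open>x + y\<close> is the
  other one; using the sum treats both cases alike and keeps the entries linear in \<open>x\<close>,
  \<open>y\<close>, \<open>z\<close>.\<close>

definition code_mat :: "nat \<Rightarrow> 'a::field \<Rightarrow> 'a \<Rightarrow> 'a \<Rightarrow> 'a \<Rightarrow> 'a mat" where
  "code_mat n a x y z = mat n n (\<lambda>(i, j).
     if j = i then (if even i then x else y)
     else if j = i + 1 then z
     else if j = i + 2 then a * (x + y) + z
     else 0)"

lemma code_mat_carrier [simp]: "code_mat n a x y z \<in> carrier_mat n n"
  by (simp add: code_mat_def)

text \<open>Extending \<open>v\<close> by zero gives one formula for all rows, including the last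
  two, where the band is cut off.\<close>

lemma code_mat_mult_vec:
  fixes v :: "'a::field vec"
  assumes v: "v \<in> carrier_vec n" and i: "i < n"
  defines "u \<equiv> \<lambda>j. if j < n then v $ j else 0"
  shows "(code_mat n a x y z *\<^sub>v v) $ i =
    (if even i then x else y) * u i + z * u (i + 1) + (a * (x + y) + z) * u (i + 2)"
proof -
  have "(code_mat n a x y z *\<^sub>v v) $ i =
    (\<Sum>j<n. (if j = i then if even i then x else y else if j = i + 1 then z
        else if j = i + 2 then a * (x + y) + z else 0) * u j)"
    using v i by (simp add: code_mat_def scalar_prod_def u_def atLeast0LessThan)
  also have "\<dots> =
    (\<Sum>j<n. (if j = i then (if even i then x else y) * u i else 0)
        + (if j = i + 1 then z * u (i + 1) else 0)
        + (if j = i + 2 then (a * (x + y) + z) * u (i + 2) else 0))"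
    by (rule sum.cong) auto
  also have "\<dots> = (if even i then x else y) * u i + z * u (i + 1) + (a * (x + y) + z) * u (i + 2)"
    using i by (simp add: sum.distrib u_def)
  finally show ?thesis .
qed

text \<open>Back substitution from the last coordinate kills all coordinates of index at least 2.
  The first two rows then leave at most one free parameter, which the condition on
  \<open>v $ k\<close> removes.\<close>

lemma code_mat_kernel:
  fixes v :: "'a::field vec"
  assumes n: "n \<ge> 2" and a: "\<And>t. t * t - t \<noteq> a" and nz: "x \<noteq> 0 \<or> y \<noteq> 0 \<or> z \<noteq> 0"
    and v: "v \<in> carrier_vec n" and ker: "code_mat n a x y z *\<^sub>v v = 0\<^sub>v n"
    and k: "v $ (if x = 0 then 0 else 1) = 0"
  shows "v = 0\<^sub>v n"
proof -
  define u where "u = (\<lambda>j. if j < n then v $ j else 0)"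
  define d where "d = (\<lambda>i::nat. if even i then x else y)"
  define f where "f = a * (x + y) + z"
  have row: "d i * u i + z * u (i + 1) + f * u (i + 2) = 0" if "i < n" for i
  proof -
    have "(code_mat n a x y z *\<^sub>v v) $ i = d i * u i + z * u (i + 1) + f * u (i + 2)"
      unfolding u_def d_def f_def by (rule code_mat_mult_vec[OF v that])
    then show ?thesis using ker that by simp
  qed
  have high: "j \<ge> n \<Longrightarrow> u j = 0" for j
    by (simp add: u_def)
  have u2: "2 \<le> j \<longrightarrow> u j = 0" for j
  proof (induction "n - j" arbitrary: j rule: less_induct)
    case less
    show ?case
    proof (intro impI)
      assume j: "2 \<le> j"
      show "u j = 0"
      proof (cases "j < n")
        case True
        have up: "u (j + 1) = 0" "u (j + 2) = 0"
          using less[of "j + 1"] less[of "j + 2"] j True by auto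
        show ?thesis
        proof (cases "d j = 0")
          case False
          then show ?thesis using row[OF True] up by simp
        next
          case d0: True
          \<comment> \<open>Row \<open>j\<close> says nothing about \<open>u j\<close> here, so the
            two rows above it are used. Row \<open>i\<close> has the same parity and thus zero
            diagonal entry; row \<open>i + 1\<close> has diagonal entry \<open>x + y\<close>.
            Eliminating \<open>u (i + 1)\<close> leaves \<open>u j\<close> times the anisotropic
            form.\<close>
          obtain i where i: "j = i + 2"
            using j by (metis add.commute le_Suc_ex)
          have di: "d i = 0" and s: "d (i + 1) = x + y"
            using d0 i by (auto simp: d_def split: if_splits)
          have "z * u (i + 1) + f * u j = 0"
            using row[of i] True i di by simp
          moreover have "(x + y) * u (i + 1) + z * u j = 0"
            using row[of "i + 1"] True i s up by simp
          moreover have "((x + y) * f - z * z) * u j =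
              (x + y) * (z * u (i + 1) + f * u j) - z * ((x + y) * u (i + 1) + z * u j)"
            by (simp add: algebra_simps)
          ultimately have "((x + y) * f - z * z) * u j = 0"
            by simp
          moreover have "(x + y) * f - z * z \<noteq> 0"
          proof
            assume "(x + y) * f - z * z = 0"
            then have "x + y = 0 \<and> z = 0"
              unfolding f_def by (rule binary_form_anisotropic[OF a])
            moreover have "x = 0 \<or> y = 0"
              using d0 by (auto simp: d_def split: if_splits)
            ultimately show False
              using nz by auto
          qed
          ultimately show ?thesis by simp
        qed
      qed (simp add: high)
    qed
  qed
  have r1: "y * u 1 = 0" and r0: "x * u 0 + z * u 1 = 0"
    using row[of 1] row[of 0] n u2[of 2] u2[of 3] by (simp_all add: d_def numeral_eq_Suc)
  \<comment> \<open>If \<open>x = 0\<close>, then \<open>y\<close> or \<open>z\<close> is nonzero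
    and forces \<open>u 1 = 0\<close>, while \<open>u 0\<close> is free and killed by
    \<open>k\<close>. Otherwise \<open>k\<close> gives \<open>u 1 = 0\<close>, and then
    \<open>x * u 0 = 0\<close>.\<close>
  have "u 0 = 0 \<and> u 1 = 0"
    using r0 r1 k nz n by (auto simp: u_def split: if_splits)
  then have "u j = 0" for j
    using u2[of j] by (cases "j = 0"; cases "j = 1") auto
  then show ?thesis
    using v by (auto intro!: eq_vecI simp: u_def split: if_splits) metis
qed

lemma code_mat_rank_ge:
  fixes a x y z :: "'a::field"
  assumes "n \<ge> 2" and "\<And>t. t * t - t \<noteq> a" and "x \<noteq> 0 \<or> y \<noteq> 0 \<or> z \<noteq> 0"
  shows "n - 1 \<le> vec_space.rank n (code_mat n a x y z)"
proof -
  have "n \<le> Suc (vec_space.rank n (code_mat n a x y z))"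
  proof (rule rank_Suc_ge[where k = "if x = 0 then 0 else 1"])
    show "(if x = 0 then 0 else 1) < n" using assms(1) by simp
  qed (use code_mat_kernel[OF assms] in auto)
  then show ?thesis by simp
qed

text \<open>The zero diagonal makes the determinant vanish, so the lower bound n - 1 is
  attained.\<close>

lemma code_mat_rank_nilpotent:
  assumes n: "n \<ge> 2" and a: "\<And>t::'a::field. t * t - t \<noteq> a"
  shows "vec_space.rank n (code_mat n a 0 0 1) = n - 1"
proof -
  let ?M = "code_mat n a 0 0 1"
  have "det ?M = prod_list (diag_mat ?M)"
    by (rule det_upper_triangular[of _ n]) (auto simp: code_mat_def)
  also have "\<dots> = 0"
    using n by (auto simp: diag_mat_def code_mat_def image_constant_conv)
  finally have "vec_space.rank n ?M \<noteq> n"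
    using vec_space.det_rank_iff[of ?M n] by simp
  moreover have "vec_space.rank n ?M \<le> n"
    by (rule vec_space.rank_le_nc) simp
  ultimately show ?thesis
    using code_mat_rank_ge[OF n a, of 0 0 1] by simp
qed

lemma code_mat_eq_0_iff:
  assumes "n \<ge> 2"
  shows "code_mat n a x y z = 0\<^sub>m n n \<longleftrightarrow> x = 0 \<and> y = 0 \<and> z = 0"
proof
  assume "code_mat n a x y z = 0\<^sub>m n n"
  then have *: "code_mat n a x y z $$ (i, j) = 0" if "i < n" "j < n" for i j
    using that by simp
  show "x = 0 \<and> y = 0 \<and> z = 0"
    \<comment> \<open>These three entries already determine the parameters and exist even for
      \<open>n = 2\<close>, where the second superdiagonal is empty.\<close>
    using *[of 0 0] *[of 1 1] *[of 0 1] assms by (simp add: code_mat_def)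
qed (auto simp: code_mat_def)

section \<open>Linear parametrisation and dimension of the code\<close>

definition code_map :: "nat \<Rightarrow> 'a::field \<Rightarrow> 'a vec \<Rightarrow> 'a mat" where
  "code_map n a v = code_mat n a (v $ 0) (v $ 1) (v $ 2)"

lemma code_map_linear:
  "linear_map class_ring (module_vec TYPE('a::field) 3) (module_mat TYPE('a) n n) (code_map n a)"
proof -
  have "mod_hom class_ring (module_vec TYPE('a) 3) (module_mat TYPE('a) n n) (code_map n a)"
    unfolding mod_hom_def mod_hom_axioms_def LinearCombinations.module_hom_def
    using vec_vs[of 3] matrix_vs[of n n]
    by (auto simp: vectorspace_def code_map_def code_mat_def module_mat_simps module_vec_simps
        algebra_simps)
  then show ?thesis
    unfolding linear_map_def using vec_vs matrix_vs by blast
qed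

lemma code_map_inj:
  assumes n: "n \<ge> 2"
  shows "inj_on (code_map n a) (carrier_vec 3)"
proof (rule inj_onI)
  fix v w assume v: "v \<in> carrier_vec 3" and w: "w \<in> carrier_vec 3"
    and eq: "code_map n a v = code_map n a w"
  have "code_map n a v $$ (i, j) = code_map n a w $$ (i, j)" for i j
    using eq by simp
  from this[of 0 0] this[of 1 1] this[of 0 1] have "v $ 0 = w $ 0" "v $ 1 = w $ 1" "v $ 2 = w $ 2"
    using n by (simp_all add: code_map_def code_mat_def)
  then show "v = w"
    using v w by (auto intro!: eq_vecI simp: less_Suc_eq numeral_3_eq_3 numeral_2_eq_2)
qed

lemma image_code_map:
  "code_map n a ` carrier_vec 3 = {code_mat n a x y z |x y z. True}"
proof safe
  fix x y z
  show "code_mat n a x y z \<in> code_map n a ` carrier_vec 3"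
    by (rule image_eqI[of _ _ "vec_of_list [x, y, z]"])
      (auto simp: code_map_def vec_of_list_index numeral_2_eq_2 intro!: carrier_vecI)
qed (auto simp: code_map_def)

text \<open>The code is the image of the injective linear map \<open>code_map n a\<close> on a space
  of dimension 3, so rank-nullity with trivial kernel applies.\<close>

lemma code_subspace_dim:
  fixes a :: "'a::field"
  assumes n: "n \<ge> 2"
  defines "C \<equiv> {code_mat n a x y z |x y z. True}"
  shows "subspace class_ring C (module_mat TYPE('a) n n)" and "mat_dim n n C = 3"
proof -
  interpret T: linear_map class_ring "module_vec TYPE('a) 3" "module_mat TYPE('a) n n" "code_map n a"
    by (rule code_map_linear)
  have im: "T.im = C"
    unfolding T.im_def C_def image_code_map[symmetric] by (simp add: module_vec_simps)
  show "subspace class_ring C (module_mat TYPE('a) n n)"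
    using T.imT_is_subspace im by simp
  have "inj_on (code_map n a) (carrier (module_vec TYPE('a) 3))"
    using code_map_inj[OF n] by (simp add: module_vec_simps)
  from T.inj_imp_dim_ker0[OF this] T.rank_nullity[OF vec_space.fin_dim]
  show "mat_dim n n C = 3"
    by (simp add: mat_dim_def im vec_space.dim_is_n)
qed

section \<open>The staircase diagram and its dimension bound\<close>

lemma upper_triangular_ferrers_space:
  "ferrers_space n [1..<n + 1] = {A \<in> carrier_mat n n. upper_triangular A}"
proof -
  have "(\<forall>i<n. \<forall>j<n. A $$ (i, j) \<noteq> 0 \<longrightarrow> (i + 1, j + 1) \<in> ferrers [1..<n + 1])
    \<longleftrightarrow> upper_triangular A" if "A \<in> carrier_mat n n" for A :: "'a mat"
  proof -
    have "(i + 1, j + 1) \<in> ferrers [1..<n + 1] \<longleftrightarrow> \<not> j < i" if "j < n" for i j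
      using that by (auto simp: ferrers_def simp del: upt_Suc)
    then have "(\<forall>i<n. \<forall>j<n. A $$ (i, j) \<noteq> 0 \<longrightarrow> (i + 1, j + 1) \<in> ferrers [1..<n + 1])
      \<longleftrightarrow> (\<forall>i<n. \<forall>j<n. j < i \<longrightarrow> A $$ (i, j) = 0)"
      by blast
    also have "\<dots> \<longleftrightarrow> upper_triangular A"
      using that by (auto simp: upper_triangular_def)
    finally show ?thesis .
  qed
  then show ?thesis
    by (simp add: ferrers_space_def del: upt_Suc cong: conj_cong)
qed

text \<open>All the numbers \<nu>_j agree: the sum runs up to \<open>t = j + 2\<close>, and only the
  last two columns reach below row \<open>j\<close>, contributing 1 + 2.\<close>

lemma nu_min_staircase:
  assumes "n \<ge> 2"
  shows "nu_min [1..<n + 1] (n - 1) = 3"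
proof -
  have "nu [1..<n + 1] (n - 1) j = 3" if "j < n - 1" for j
  proof -
    \<comment> \<open>The condition \<open>j < n - 1\<close> keeps the index \<open>j + 2\<close>
      within the \<open>n\<close> columns.\<close>
    have "nu [1..<n + 1] (n - 1) j = (\<Sum>t = 1..j + 2. t - j)"
      unfolding nu_def using that assms by (intro sum.cong) (auto simp: nth_upt simp del: upt_Suc)
    also have "\<dots> = (\<Sum>t\<in>{j + 1, j + 2}. t - j)"
      by (rule sum.mono_neutral_right) auto
    finally show ?thesis by simp
  qed
  then have "nu [1..<n + 1] (n - 1) ` {0..<n - 1} = (\<lambda>_. 3) ` {0..<n - 1}"
    by (intro image_cong) auto
  also have "\<dots> = {3}"
    using assms by (simp add: image_constant_conv)
  finally have "nu [1..<n + 1] (n - 1) ` {0..<n - 1} = {3}" .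
  then show ?thesis by (simp add: nu_min_def)
qed

section \<open>Existence of the maximal code\<close>

theorem theorem5p2:
  fixes n :: nat
  assumes "n \<ge> 2"
  shows "(ferrers_space n [1..<n + 1] :: 'a::{field,finite} mat set) =
           {A \<in> carrier_mat n n. upper_triangular A} \<and>
         nu_min [1..<n + 1] (n - 1) = 3 \<and>
         (\<exists>C :: 'a mat set. maximal_ferrers_code n [1..<n + 1] (n - 1) C)"
proof -
  obtain a :: 'a where a: "\<And>t. t * t - t \<noteq> a"
    using exists_square_minus_self_avoids by blast
  define C where "C = {code_mat n a x y z |x y z. True}"
  have len: "length [1..<n + 1] = n" by simp
  have "C \<subseteq> {A \<in> carrier_mat n n. upper_triangular A}"
    by (auto simp: C_def code_mat_def upper_triangular_def)
  then have sub: "C \<subseteq> ferrers_space n [1..<n + 1]"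
    by (simp only: upper_triangular_ferrers_space)
  have "rank_distance n n C = n - 1"
    unfolding rank_distance_def
  proof (rule cInf_eq_minimum)
    have "code_mat n a 0 0 1 \<in> C - {0\<^sub>m n n}"
      using code_mat_eq_0_iff[OF assms, of a 0 0 1] by (auto simp: C_def)
    then show "n - 1 \<in> vec_space.rank n ` (C - {0\<^sub>m n n})"
      using code_mat_rank_nilpotent[OF assms a] by (metis image_eqI)
  next
    fix r assume "r \<in> vec_space.rank n ` (C - {0\<^sub>m n n})"
    then obtain x y z where "r = vec_space.rank n (code_mat n a x y z)"
        "code_mat n a x y z \<noteq> 0\<^sub>m n n"
      by (auto simp: C_def)
    then show "n - 1 \<le> r"
      using code_mat_eq_0_iff[OF assms] code_mat_rank_ge[OF assms a] by metis
  qed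
  then have "maximal_ferrers_code n [1..<n + 1] (n - 1) C"
    unfolding maximal_ferrers_code_def len nu_min_staircase[OF assms]
    using code_subspace_dim[OF assms, of a] sub by (simp add: C_def)
  then show ?thesis
    using upper_triangular_ferrers_space nu_min_staircase[OF assms] by blast
qed

end
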